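(* Let $d\ge 2$, let $\mathcal{Y}=\mathcal{C}\times_1\mathbf{U}_1\cdots\times_d\mathbf{U}_d\in\mathscr{M}_{\mathbf{r}}$ with core $\mathcal{C}\in\mathbb{R}^{r_1\times\cdots\times r_d}$ and factor matrices $\mathbf{U}_k\in\mathbb{R}^{I_k\times r_k}$ having orthonormal columns. Let $h>0$, fix $n\in\{1,\dots,d\}$, and let $\dot{\mathcal{A}}\in\mathbb{R}^{I_1\times\cdots\times I_d}$, $\dot{\mathcal{C}}\in\mathbb{R}^{r_1\times\cdots\times r_d}$ and $\dot{\mathbf{U}}_k\in\mathbb{R}^{I_k\times r_k}$ ($k\neq n$) be given and fixed. For $\mathbf{W}\in\mathbb{R}^{I_n\times r_n}$ let $$f_n(\mathbf{W})=\|\mathbf{W}\mathbf{C}_{(n)}\|^2-2\Big\langle\mathbf{W},\Big[\dot{\mathcal{A}}\times_1\mathbf{U}_1^T\cdots\times_{n-1}\mathbf{U}_{n-1}^T\times_{n+1}\mathbf{U}_{n+1}^T\cdots\times_d\mathbf{U}_d^T\Big]_{(n)}\mathbf{C}_{(n)}^T\Big\rangle+2\big\langle\mathbf{W},\mathbf{U}_n\dot{\mathbf{C}}_{(n)}\mathbf{C}_{(n)}^T\big\rangle+2\sum_{\ell\ne n}\big\langle\mathbf{W},\mathbf{U}_n\big[\mathcal{C}\times_\ell\mathbf{U}_\ell^T\dot{\mathbf{U}}_\ell\big]_{(n)}\mathbf{C}_{(n)}^T\big\rangle,$$ and for $\mathbf{V}_n\in\mathbb{R}^{I_n\times r_n}$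 let $\widetilde f_n(\mathbf{V}_n)=f_n\big(\tfrac1h(\mathbf{V}_n-\mathbf{U}_n)\big)$. Then the optimization problem $$\min_{\mathbf{V}_n^T\mathbf{V}_n=\mathbf{I}}\widetilde f_n(\mathbf{V}_n)$$ is equivalent to the trace optimization problem $$\max_{\mathbf{V}_n^T\mathbf{V}_n=\mathbf{I}}\mathrm{Tr}\big[\mathbf{B}_n^T\mathbf{V}_n\big],$$ where $$\mathbf{B}_n=\Big(\Big[\dot{\mathcal{A}}\times_1\mathbf{U}_1^T\cdots\times_{n-1}\mathbf{U}_{n-1}^T\times_{n+1}\mathbf{U}_{n+1}^T\cdots\times_d\mathbf{U}_d^T\Big]_{(n)}-\mathbf{U}_n\dot{\mathbf{C}}_{(n)}-\mathbf{U}_n\sum_{k\ne n}\big[\mathcal{C}\times_k\mathbf{U}_k^T\dot{\mathbf{U}}_k\big]_{(n)}\Big)\mathbf{C}_{(n)}^T+\tfrac1h\,\mathbf{U}_n\mathbf{C}_{(n)}\mathbf{C}_{(n)}^T .$$ Moreover, given the (economy size) singular value decomposition $\mathbf{B}_n=\mathbf{R}_n\boldsymbol{\Sigma}_n\mathbf{T}_n^T$ with $\mathbf{R}_n\in\mathbb{R}^{I_n\times r_n}$, $\mathbf{T}_n\in\mathbb{R}^{r_n\times r_n}$ and the diagonal matrix $\boldsymbol{\Sigma}_n\in\mathbb{R}^{r_n\times r_n}$, the solution $\mathbf{U}_n^h$ to the trace optimization problem is given by $$\mathbf{V}_n^\ast\equiv\mathbf{U}_n^h=\mathbf{R}_n\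mathbf{T}_n^T.$$
   Context: All tensors and matrices are real, and $\langle\cdot,\cdot\rangle$, $\|\cdot\|$ denote the Frobenius inner product and norm for matrices. The constraint sets consist of all $\mathbf{V}_n\in\mathbb{R}^{I_n\times r_n}$ with orthonormal columns ($\mathbf{V}_n^T\mathbf{V}_n=\mathbf{I}$); it is assumed that $r_n\le I_n$. In the economy size singular value decomposition, as usual, $\mathbf{R}_n$ has orthonormal columns, $\mathbf{T}_n$ is orthogonal and $\boldsymbol{\Sigma}_n$ has nonnegative diagonal entries. The $n$th unfolding $[\mathcal{X}]_{(n)}=\mathbf{X}_{(n)}\in\mathbb{R}^{I_n\times\prod_{j\ne n}I_j}$ of $\mathcal{X}\in\mathbb{R}^{I_1\times\cdots\times I_d}$ is the matrix whose columns are the mode-$n$ fibers of $\mathcal{X}$ (all indices fixed except the $n$th), in a fixed ordering. In particular $\mathbf{C}_{(n)}=[\mathcal{C}]_{(n)}$ and $\dot{\mathbf{C}}_{(n)}=[\dot{\mathcal{C}}]_{(n)}$. The $n$-mode product $\mathcal{X}\times_n\mathbf{U}$ with a matrix $\mathbf{U}\in\mathbb{R}^{J_n\times I_n}$ is the tensor defined by $[\mathcal{X}\times_n\mathbf{U}]_{(n)}=\mathbf{U}\mathbf{X}_{(n)}$; products in different modes commute. The notation $\mathcal{X}\times_1\mathbf{U}_1^T\cdots\times_{n-1}\mathbf{U}_{n-1}^T\times_{n+1}\mathbf{U}_{n+1}^T\cdots\times_d\mathbf{U}_d^T$ means the successive mode products over all modes $k\neq n$. $\mathscr{M}_{\mathbf{r}}=\{\mathcal{X}\in\mathbb{R}^{I_1\times\cdots\times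 I_d}:\ \mathrm{rank}(\mathbf{X}_{(n)})=r_n,\ n=1,\dots,d\}$ is the manifold of tensors of Tucker rank $\mathbf{r}=(r_1,\dots,r_d)^T$. The setting is one Euler step of length $h$, from time $t$ to $t+h$, for fitting a time-dependent tensor $\mathcal{A}(t)$ by $\mathcal{Y}(t)\in\mathscr{M}_{\mathbf{r}}$ (minimizing $\|\dot{\mathcal{Y}}-\dot{\mathcal{A}}\|$ over the tangent space of $\mathscr{M}_{\mathbf{r}}$ at $\mathcal{Y}$) by alternating least squares: $\dot{\mathcal{A}}$ is the known derivative at time $t$, and $\dot{\mathcal{C}}$ and $\dot{\mathbf{U}}_k$, $k\ne n$, are core and factor derivatives that are kept fixed. The updated factor matrix $\mathbf{U}_n^h=\mathbf{U}_n(t+h)$ is defined as the solution of the constrained minimization problem for $\widetilde f_n$. *)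

theory Defs
  imports "Jordan_Normal_Form.DL_Rank"
begin

section \<open>Tensors of arbitrary order\<close>

text \<open>A real tensor is given by the list of its dimensions and its entries, indexed by lists of
  natural numbers. Modes and indices are counted from 0. Entries outside the index range are 0, so
  that equality of tensors is equality of the dimensions and of all entries.\<close>

definition multi_index :: "nat list \<Rightarrow> nat list set" where
  "multi_index ds = {idx. list_all2 (<) idx ds}"

typedef tensor =
  "{(ds, f) :: nat list \<times> (nat list \<Rightarrow> real) | ds f. \<forall>idx. idx \<notin> multi_index ds \<longrightarrow> f idx = 0}"
  by (rule exI[of _ "([], \<lambda>_. 0)"]) simp

definition dims :: "tensor \<Rightarrow> nat list" where
  "dims X = fst (Rep_tensor X)"

definition entry :: "tensor \<Rightarrow> nat list \<Rightarrow> real" where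
  "entry X = snd (Rep_tensor X)"

definition tensor_of :: "nat list \<Rightarrow> (nat list \<Rightarrow> real) \<Rightarrow> tensor" where
  "tensor_of ds f = Abs_tensor (ds, \<lambda>idx. if idx \<in> multi_index ds then f idx else 0)"

definition tensors :: "nat list \<Rightarrow> tensor set" where
  "tensors ds = {X. dims X = ds}"

lemma Rep_tensor_of:
  "Rep_tensor (tensor_of ds f) = (ds, \<lambda>idx. if idx \<in> multi_index ds then f idx else 0)"
  unfolding tensor_of_def by (rule Abs_tensor_inverse) simp

lemma dims_tensor_of [simp]: "dims (tensor_of ds f) = ds"
  by (simp add: dims_def Rep_tensor_of)

lemma entry_tensor_of:
  "entry (tensor_of ds f) idx = (if idx \<in> multi_index ds then f idx else 0)"
  by (simp add: entry_def Rep_tensor_of)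

lemma entry_outside: "idx \<notin> multi_index (dims X) \<Longrightarrow> entry X idx = 0"
  using Rep_tensor[of X] by (auto simp: entry_def dims_def)

lemma tensor_eqI:
  assumes "dims X = dims Y" and "\<And>idx. idx \<in> multi_index (dims X) \<Longrightarrow> entry X idx = entry Y idx"
  shows "X = Y"
proof -
  have "entry X = entry Y"
    using assms entry_outside[of _ X] entry_outside[of _ Y] by (metis ext)
  with assms(1) have "Rep_tensor X = Rep_tensor Y"
    by (simp add: dims_def entry_def prod_eq_iff)
  then show ?thesis
    by (simp add: Rep_tensor_inject)
qed


section \<open>Unfoldings and mode products\<close>

definition remove_nth :: "nat \<Rightarrow> 'a list \<Rightarrow> 'a list" where
  "remove_nth n xs = take n xs @ drop (Suc n) xs"

definition insert_nth :: "nat \<Rightarrow> 'a \<Rightarrow> 'a list \<Rightarrow> 'a list" where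
  "insert_nth n x xs = take n xs @ x # drop n xs"

text \<open>\<open>digits ds\<close> enumerates the multi-indices for the dimensions \<open>ds\<close>, the first index running
  fastest; this fixes the ordering of the columns of the unfoldings.\<close>

fun digits :: "nat list \<Rightarrow> nat \<Rightarrow> nat list" where
  "digits [] j = []"
| "digits (m # ms) j = (j mod m) # digits ms (j div m)"

definition unfold :: "nat \<Rightarrow> tensor \<Rightarrow> real mat" where
  "unfold n X = (let ds = remove_nth n (dims X) in
     mat (dims X ! n) (prod_list ds) (\<lambda>(i, j). entry X (insert_nth n i (digits ds j))))"

definition mode_prod :: "tensor \<Rightarrow> nat \<Rightarrow> real mat \<Rightarrow> tensor" where
  "mode_prod X n U = tensor_of ((dims X)[n := dim_row U])
     (\<lambda>idx. \<Sum>i<dims X ! n. U $$ (idx ! n, i) * entry X (idx[n := i]))"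

definition mode_prods :: "nat list \<Rightarrow> tensor \<Rightarrow> (nat \<Rightarrow> real mat) \<Rightarrow> tensor" where
  "mode_prods ks X U = fold (\<lambda>k Z. mode_prod Z k (U k)) ks X"

definition tucker :: "tensor \<Rightarrow> (nat \<Rightarrow> real mat) \<Rightarrow> tensor" where
  "tucker C U = mode_prods [0..<length (dims C)] C U"

definition project_except :: "nat \<Rightarrow> tensor \<Rightarrow> (nat \<Rightarrow> real mat) \<Rightarrow> tensor" where
  "project_except n X U =
     mode_prods (filter (\<lambda>k. k \<noteq> n) [0..<length (dims X)]) X (\<lambda>k. transpose_mat (U k))"

definition tucker_manifold :: "nat list \<Rightarrow> nat list \<Rightarrow> tensor set" where
  "tucker_manifold ds rs = {X \<in> tensors ds.
     length rs = length ds \<and> (\<forall>n<length ds. vec_space.rank (ds ! n) (unfold n X) = rs ! n)}"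

lemma bij_betw_digits: "bij_betw (digits ds) {..<prod_list ds} (multi_index ds)"
proof (rule bij_betwI')
  fix i j assume "i \<in> {..<prod_list ds}" "j \<in> {..<prod_list ds}"
  then show "(digits ds i = digits ds j) = (i = j)"
  proof (induction ds arbitrary: i j)
    case (Cons m ms)
    then have "i div m < prod_list ms" "j div m < prod_list ms"
      by (auto simp: less_mult_imp_div_less mult.commute)
    with Cons.IH[of "i div m" "j div m"] show ?case
      by auto (metis div_mult_mod_eq)
  qed auto
next
  fix j assume "j \<in> {..<prod_list ds}"
  then show "digits ds j \<in> multi_index ds"
  proof (induction ds arbitrary: j)
    case (Cons m ms)
    then have "m > 0" "j div m < prod_list ms"
      by (auto simp: less_mult_imp_div_less mult.commute intro!: gr0I)
    with Cons.IH[of "j div m"] show ?case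
      by (auto simp: multi_index_def)
  qed (auto simp: multi_index_def)
next
  fix idx assume "idx \<in> multi_index ds"
  then show "\<exists>j\<in>{..<prod_list ds}. idx = digits ds j"
  proof (induction ds arbitrary: idx)
    case (Cons m ms)
    then obtain i js where idx: "idx = i # js" "i < m" "js \<in> multi_index ms"
      by (auto simp: multi_index_def list_all2_Cons2)
    with Cons.IH obtain j where j: "j < prod_list ms" "js = digits ms j"
      by auto
    have "i + m * j < m + m * j"
      using idx by simp
    also have "\<dots> \<le> m * prod_list ms"
      using j by (metis Suc_leI mult_Suc_right mult_le_mono2)
    finally show ?case
      using idx j by (auto intro!: bexI[of _ "i + m * j"])
  qed (auto simp: multi_index_def)
qed

text \<open>The defining property of the mode product.\<close>

lemma unfold_mode_prod:
  assumes n: "n < length (dims X)" and U: "dim_col U = dims X ! n"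
  shows "unfold n (mode_prod X n U) = U * unfold n X"
proof -
  define ds where "ds = remove_nth n (dims X)"
  have ds: "remove_nth n ((dims X)[n := dim_row U]) = ds"
    using n by (simp add: ds_def remove_nth_def)
  have split: "(dims X)[n := dim_row U] = take n ds @ dim_row U # drop n ds"
    using n by (simp add: ds_def remove_nth_def upd_conv_take_nth_drop min_def)
  have len: "length ds \<ge> n"
    using n by (simp add: ds_def remove_nth_def)
  have dimsn: "dims (mode_prod X n U) = (dims X)[n := dim_row U]"
    by (simp add: mode_prod_def)
  show ?thesis
  proof (rule eq_matI)
    fix i j assume "i < dim_row (U * unfold n X)" "j < dim_col (U * unfold n X)"
    then have i: "i < dim_row U" and j: "j < prod_list ds"
      by (auto simp: unfold_def Let_def ds_def)
    define js where "js = digits ds j"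
    have "js \<in> multi_index ds"
      using bij_betwE[OF bij_betw_digits, of ds] j by (auto simp: js_def)
    then have js: "list_all2 (<) js ds"
      by (simp add: multi_index_def)
    then have ljs: "length js = length ds"
      by (rule list_all2_lengthD)
    have mem: "insert_nth n i js \<in> multi_index ((dims X)[n := dim_row U])"
      unfolding split insert_nth_def multi_index_def
      using js i by (auto intro!: list_all2_appendI list_all2_takeI list_all2_dropI)
    have nth: "insert_nth n i js ! n = i" "\<And>k. (insert_nth n i js)[n := k] = insert_nth n k js"
      using ljs len by (auto simp: insert_nth_def nth_append list_update_append)
    have "unfold n (mode_prod X n U) $$ (i, j) = (\<Sum>k<dims X ! n. U $$ (i, k) * entry X (insert_nth n k js))"
      using i j n mem nth
      by (simp add: unfold_def Let_def dimsn ds js_def[symmetric])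
         (simp add: mode_prod_def entry_tensor_of)
    also have "\<dots> = (U * unfold n X) $$ (i, j)"
      using i j U
      by (auto simp: unfold_def Let_def ds_def[symmetric] scalar_prod_def js_def lessThan_atLeast0)
    finally show "unfold n (mode_prod X n U) $$ (i, j) = (U * unfold n X) $$ (i, j)" .
  qed (use n in \<open>auto simp: unfold_def Let_def dimsn ds ds_def\<close>)
qed


section \<open>Matrices\<close>

definition frob_inner :: "real mat \<Rightarrow> real mat \<Rightarrow> real" where
  "frob_inner A B = (\<Sum>i<dim_row A. \<Sum>j<dim_col A. A $$ (i, j) * B $$ (i, j))"

definition frob_norm :: "real mat \<Rightarrow> real" where
  "frob_norm A = sqrt (frob_inner A A)"

definition mat_trace :: "real mat \<Rightarrow> real" where
  "mat_trace A = (\<Sum>i<dim_row A. A $$ (i, i))"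

definition mat_sum :: "nat \<Rightarrow> nat \<Rightarrow> ('k \<Rightarrow> real mat) \<Rightarrow> 'k set \<Rightarrow> real mat" where
  "mat_sum nr nc M K = mat nr nc (\<lambda>ij. \<Sum>k\<in>K. M k $$ ij)"

definition stiefel :: "nat \<Rightarrow> nat \<Rightarrow> real mat set" where
  "stiefel m r = {V \<in> carrier_mat m r. transpose_mat V * V = 1\<^sub>m r}"

text \<open>For the square matrix \<open>T\<close>, membership in \<open>stiefel r r\<close> is orthogonality.\<close>

definition economy_svd :: "nat \<Rightarrow> nat \<Rightarrow> real mat \<Rightarrow> real mat \<Rightarrow> real mat \<Rightarrow> real mat \<Rightarrow> bool" where
  "economy_svd m r B R S T \<longleftrightarrow>
     R \<in> stiefel m r \<and> T \<in> stiefel r r \<and>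
     S \<in> carrier_mat r r \<and> diagonal_mat S \<and> (\<forall>i<r. 0 \<le> S $$ (i, i)) \<and>
     B = R * S * transpose_mat T"


section \<open>The factor update\<close>

text \<open>Here \<open>dA\<close>, \<open>dC\<close> and \<open>dU k\<close> stand for the given derivatives of the tensor to be fitted, of
  the core and of the factors.\<close>

definition als_objective ::
  "nat \<Rightarrow> tensor \<Rightarrow> (nat \<Rightarrow> real mat) \<Rightarrow> tensor \<Rightarrow> tensor \<Rightarrow> (nat \<Rightarrow> real mat) \<Rightarrow> real mat \<Rightarrow> real" where
  "als_objective n C U dA dC dU W =
     (frob_norm (W * unfold n C))\<^sup>2
     - 2 * frob_inner W (unfold n (project_except n dA U) * transpose_mat (unfold n C))
     + 2 * frob_inner W (U n * unfold n dC * transpose_mat (unfold n C))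
     + 2 * (\<Sum>l\<in>{..<length (dims C)} - {n}.
         frob_inner W (U n * unfold n (mode_prod C l (transpose_mat (U l) * dU l))
           * transpose_mat (unfold n C)))"

definition step_objective ::
  "real \<Rightarrow> nat \<Rightarrow> tensor \<Rightarrow> (nat \<Rightarrow> real mat) \<Rightarrow> tensor \<Rightarrow> tensor \<Rightarrow> (nat \<Rightarrow> real mat) \<Rightarrow> real mat \<Rightarrow> real" where
  "step_objective h n C U dA dC dU V = als_objective n C U dA dC dU ((1 / h) \<cdot>\<^sub>m (V - U n))"

definition trace_matrix ::
  "real \<Rightarrow> nat \<Rightarrow> tensor \<Rightarrow> (nat \<Rightarrow> real mat) \<Rightarrow> tensor \<Rightarrow> tensor \<Rightarrow> (nat \<Rightarrow> real mat) \<Rightarrow> real mat" where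
  "trace_matrix h n C U dA dC dU =
     (unfold n (project_except n dA U) - U n * unfold n dC
       - U n * mat_sum (dims C ! n) (prod_list (remove_nth n (dims C)))
           (\<lambda>k. unfold n (mode_prod C k (transpose_mat (U k) * dU k))) ({..<length (dims C)} - {n}))
       * transpose_mat (unfold n C)
     + (1 / h) \<cdot>\<^sub>m (U n * unfold n C * transpose_mat (unfold n C))"

end

theory Submission
  imports Defs
begin

text \<open>Write \<open>C\<close> for the unfolded core. For \<open>V\<close> with orthonormal columns, \<open>\<parallel>V C\<parallel>\<close> does not depend on \<open>V\<close>, so the quadratic term
  of the objective contributes only its cross term, and the objective is a constant minus
  \<open>(2 / h) \<langle>B, V\<rangle>\<close>. With \<open>B = R \<Sigma> T\<^sup>T\<close> one has \<open>\<langle>B, V\<rangle> = \<langle>R \<Sigma>, V T\<rangle>\<close>, where \<open>R\<close> and \<open>V T\<close> have unit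
  columns; hence this is at most the sum of the singular values, which is attained for
  \<open>V T = R\<close>.\<close>

section \<open>The Frobenius inner product: bilinearity, trace form and adjoints\<close>

lemma frob_inner_commute:
  assumes "A \<in> carrier_mat m r" "B \<in> carrier_mat m r"
  shows "frob_inner A B = frob_inner B A"
  using assms by (simp add: frob_inner_def mult.commute)

lemma frob_inner_add_right:
  assumes "A \<in> carrier_mat m r" "B \<in> carrier_mat m r" "B' \<in> carrier_mat m r"
  shows "frob_inner A (B + B') = frob_inner A B + frob_inner A B'"
  using assms by (simp add: frob_inner_def distrib_left sum.distrib)

lemma frob_inner_diff_right:
  assumes "A \<in> carrier_mat m r" "B \<in> carrier_mat m r" "B' \<in> carrier_mat m r"
  shows "frob_inner A (B - B') = frob_inner A B - frob_inner A B'"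
  using assms by (simp add: frob_inner_def right_diff_distrib sum_subtractf)

lemma frob_inner_diff_left:
  assumes "A \<in> carrier_mat m r" "A' \<in> carrier_mat m r" "B \<in> carrier_mat m r"
  shows "frob_inner (A - A') B = frob_inner A B - frob_inner A' B"
  using assms by (simp add: frob_inner_def left_diff_distrib sum_subtractf)

lemma frob_inner_smult_left:
  assumes "A \<in> carrier_mat m r" "B \<in> carrier_mat m r"
  shows "frob_inner (c \<cdot>\<^sub>m A) B = c * frob_inner A B"
  using assms by (simp add: frob_inner_def sum_distrib_left mult.assoc)

lemma frob_inner_smult_right:
  assumes "A \<in> carrier_mat m r" "B \<in> carrier_mat m r"
  shows "frob_inner A (c \<cdot>\<^sub>m B) = c * frob_inner A B"
  using assms by (simp add: frob_inner_def sum_distrib_left mult.left_commute)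

lemma frob_inner_mat_sum_right:
  assumes "A \<in> carrier_mat m r"
  shows "frob_inner A (mat_sum m r M K) = (\<Sum>k\<in>K. frob_inner A (M k))"
proof -
  have "frob_inner A (mat_sum m r M K) =
      (\<Sum>i<m. \<Sum>j<r. \<Sum>k\<in>K. A $$ (i, j) * M k $$ (i, j))"
    using assms by (simp add: frob_inner_def mat_sum_def sum_distrib_left)
  also have "\<dots> = (\<Sum>i<m. \<Sum>k\<in>K. \<Sum>j<r. A $$ (i, j) * M k $$ (i, j))"
    by (intro sum.cong refl sum.swap)
  also have "\<dots> = (\<Sum>k\<in>K. \<Sum>i<m. \<Sum>j<r. A $$ (i, j) * M k $$ (i, j))"
    by (rule sum.swap)
  finally show ?thesis
    using assms by (simp add: frob_inner_def)
qed

lemma frob_inner_eq_trace: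
  assumes "A \<in> carrier_mat m r" "B \<in> carrier_mat m r"
  shows "frob_inner A B = mat_trace (transpose_mat A * B)"
proof -
  have "frob_inner A B = (\<Sum>j<r. \<Sum>i<m. A $$ (i, j) * B $$ (i, j))"
    using assms unfolding frob_inner_def by (simp add: sum.swap[of _ "{..<m}"])
  then show ?thesis
    using assms by (simp add: mat_trace_def scalar_prod_def lessThan_atLeast0)
qed

lemma frob_inner_mult_left_adjoint:
  assumes "A \<in> carrier_mat m r" "B \<in> carrier_mat r p" "X \<in> carrier_mat m p"
  shows "frob_inner (A * B) X = frob_inner B (transpose_mat A * X)"
proof -
  have "frob_inner (A * B) X = mat_trace (transpose_mat B * transpose_mat A * X)"
    using assms by (simp add: frob_inner_eq_trace[of _ m p] transpose_mult)
  also have "transpose_mat B * transpose_mat A * X = transpose_mat B * (transpose_mat A * X)"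
    using assms by (intro assoc_mult_mat[of _ p r _ m _ p]) auto
  finally show ?thesis
    using assms by (simp add: frob_inner_eq_trace[of _ r p])
qed

lemma frob_inner_transpose:
  "frob_inner (transpose_mat A) (transpose_mat B) = frob_inner A B"
  if "A \<in> carrier_mat m r" "B \<in> carrier_mat m r"
  using that by (simp add: frob_inner_def sum.swap[of _ "{..<m}"])

text \<open>Transposing both arguments preserves the inner product and turns the right factor into a
  left one, so the left adjoint rule applies.\<close>

lemma frob_inner_mult_right_adjoint:
  assumes "A \<in> carrier_mat m r" "B \<in> carrier_mat r p" "X \<in> carrier_mat m p"
  shows "frob_inner (A * B) X = frob_inner A (X * transpose_mat B)"
proof -
  have "frob_inner (A * B) X = frob_inner (transpose_mat B * transpose_mat A) (transpose_mat X)"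
    using assms frob_inner_transpose[of "A * B" m p X] by (simp add: transpose_mult)
  also have "\<dots> = frob_inner (transpose_mat A) (B * transpose_mat X)"
    using assms by (subst frob_inner_mult_left_adjoint[of _ p r _ m]) auto
  also have "B * transpose_mat X = transpose_mat (X * transpose_mat B)"
    using assms by (simp add: transpose_mult[of X m p _ r])
  finally show ?thesis
    using assms by (simp add: frob_inner_transpose[of _ m r])
qed

lemma frob_norm_sq: "(frob_norm A)\<^sup>2 = frob_inner A A"
  by (simp add: frob_norm_def frob_inner_def sum_nonneg)

section \<open>Matrices with orthonormal columns\<close>

lemma stiefel_frob_inner_mult:
  assumes V: "V \<in> stiefel m r" and C: "C \<in> carrier_mat r p"
  shows "frob_inner (V * C) (V * C) = frob_inner C C"
proof -
  have Vc: "V \<in> carrier_mat m r" and VV: "transpose_mat V * V = 1\<^sub>m r"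
    using V by (auto simp: stiefel_def)
  have "transpose_mat V * (V * C) = transpose_mat V * V * C"
    using Vc C by (intro assoc_mult_mat[symmetric]) auto
  then show ?thesis
    using Vc C VV by (simp add: frob_inner_mult_left_adjoint[of _ m r _ p])
qed

lemma stiefel_mult:
  assumes V: "V \<in> stiefel m r" and T: "T \<in> stiefel r q"
  shows "V * T \<in> stiefel m q"
proof -
  have Vc: "V \<in> carrier_mat m r" and VV: "transpose_mat V * V = 1\<^sub>m r"
    and Tc: "T \<in> carrier_mat r q" and TT: "transpose_mat T * T = 1\<^sub>m q"
    using V T by (auto simp: stiefel_def)
  have "transpose_mat (V * T) * (V * T) = transpose_mat T * (transpose_mat V * (V * T))"
    using Vc Tc by (simp add: transpose_mult[of V m r T q] assoc_mult_mat[of _ q r _ m _ q])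
  also have "transpose_mat V * (V * T) = T"
    using Vc Tc VV by (simp add: assoc_mult_mat[of _ r m _ r _ q, symmetric])
  finally show ?thesis
    using Vc Tc TT by (simp add: stiefel_def)
qed

text \<open>A left inverse of a square matrix is also a right inverse. This places
  \<open>R * transpose_mat T\<close> in the feasible set.\<close>

lemma stiefel_transpose:
  assumes "T \<in> stiefel r r"
  shows "transpose_mat T \<in> stiefel r r"
  using assms mat_mult_left_right_inverse[of "transpose_mat T" r T] by (simp add: stiefel_def)

text \<open>The column norms are read off the diagonal of \<open>transpose_mat V * V\<close>; they
  feed the columnwise estimate in the trace bound.\<close>

lemma stiefel_column:
  assumes "V \<in> stiefel m r" "j < r"
  shows "(\<Sum>i<m. (V $$ (i, j))\<^sup>2) = 1"
proof -
  have V: "V \<in> carrier_mat m r" and "(transpose_mat V * V) $$ (j, j) = 1"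
    using assms by (auto simp: stiefel_def)
  then show ?thesis
    using assms(2) by (simp add: scalar_prod_def lessThan_atLeast0 power2_eq_square)
qed

section \<open>Maximizing the trace by a singular value decomposition\<close>

lemma frob_inner_mult_diagonal:
  assumes R: "R \<in> carrier_mat m r" and S: "S \<in> carrier_mat r r" "diagonal_mat S"
    and M: "M \<in> carrier_mat m r"
  shows "frob_inner (R * S) M = (\<Sum>j<r. S $$ (j, j) * (\<Sum>i<m. R $$ (i, j) * M $$ (i, j)))"
proof -
  have RS: "(R * S) $$ (i, j) = R $$ (i, j) * S $$ (j, j)" if "i < m" "j < r" for i j
  proof -
    have "(R * S) $$ (i, j) = (\<Sum>k<r. R $$ (i, k) * S $$ (k, j))"
      using R S that by (simp add: scalar_prod_def lessThan_atLeast0)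
    also have "\<dots> = (\<Sum>k<r. if k = j then R $$ (i, j) * S $$ (j, j) else 0)"
      using S that by (intro sum.cong) (auto simp: diagonal_mat_def)
    also have "\<dots> = R $$ (i, j) * S $$ (j, j)"
      using that by simp
    finally show ?thesis .
  qed
  have "frob_inner (R * S) M = (\<Sum>i<m. \<Sum>j<r. R $$ (i, j) * S $$ (j, j) * M $$ (i, j))"
    unfolding frob_inner_def
    by (rule sum.cong[OF _ sum.cong]) (use R S RS in \<open>auto\<close>)
  also have "\<dots> = (\<Sum>j<r. \<Sum>i<m. R $$ (i, j) * S $$ (j, j) * M $$ (i, j))"
    by (rule sum.swap)
  finally show ?thesis
    by (simp add: sum_distrib_left mult_ac)
qed

lemma economy_svd_is_arg_max:
  assumes svd: "economy_svd m r B R S T"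
  shows "is_arg_max (\<lambda>V. frob_inner B V) (\<lambda>V. V \<in> stiefel m r) (R * transpose_mat T)"
proof -
  have R: "R \<in> stiefel m r" and T: "T \<in> stiefel r r" and S: "S \<in> carrier_mat r r" "diagonal_mat S"
    and nonneg: "\<And>j. j < r \<Longrightarrow> 0 \<le> S $$ (j, j)" and B: "B = R * S * transpose_mat T"
    using svd by (auto simp: economy_svd_def)
  have Rc: "R \<in> carrier_mat m r" and Tc: "T \<in> carrier_mat r r"
    and TT: "transpose_mat T * T = 1\<^sub>m r"
    using R T by (auto simp: stiefel_def)
  \<comment> \<open>Moving the factor \<open>transpose_mat T\<close> to the other argument leaves
    \<open>R * S\<close> against \<open>V * T\<close>, and the diagonal \<open>S\<close> splits this
    by columns.\<close>
  have inner: "frob_inner B V = (\<Sum>j<r. S $$ (j, j) * (\<Sum>i<m. R $$ (i, j) * (V * T) $$ (i, j)))"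
    if "V \<in> carrier_mat m r" for V
    using that Rc Tc S unfolding B
    by (subst frob_inner_mult_right_adjoint[of _ m r _ r])
       (auto simp: frob_inner_mult_diagonal[of _ m r])
  have "frob_inner B V \<le> (\<Sum>j<r. S $$ (j, j))" if V: "V \<in> stiefel m r" for V
  proof -
    have "(\<Sum>i<m. R $$ (i, j) * (V * T) $$ (i, j)) \<le> 1" if j: "j < r" for j
    proof -
      \<comment> \<open>The termwise bound \<open>2 a b \<le> a^2 + b^2\<close> does the work of
        Cauchy-Schwarz, because both columns have norm 1.\<close>
      have "2 * (\<Sum>i<m. R $$ (i, j) * (V * T) $$ (i, j))
          \<le> (\<Sum>i<m. (R $$ (i, j))\<^sup>2 + ((V * T) $$ (i, j))\<^sup>2)"
        unfolding sum_distrib_left mult.assoc[symmetric]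
        by (intro sum_mono sum_squares_bound)
      also have "\<dots> = 2"
        using stiefel_column[OF R j] stiefel_column[OF stiefel_mult[OF V T] j]
        by (simp add: sum.distrib)
      finally show ?thesis by simp
    qed
    \<comment> \<open>Weighting the column bounds preserves the inequality because singular values
      are nonnegative.\<close>
    then have "S $$ (j, j) * (\<Sum>i<m. R $$ (i, j) * (V * T) $$ (i, j)) \<le> S $$ (j, j)"
      if "j < r" for j
      using mult_left_mono[OF _ nonneg[OF that]] that by fastforce
    then show ?thesis
      using V by (auto simp: inner stiefel_def intro!: sum_mono)
  qed
  moreover have "R * transpose_mat T \<in> stiefel m r"
    using stiefel_mult[OF R stiefel_transpose[OF T]] .
  moreover have "frob_inner B (R * transpose_mat T) = (\<Sum>j<r. S $$ (j, j))"
  proof -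
    \<comment> \<open>For this candidate \<open>V * T\<close> is \<open>R\<close> itself, so each
      column product is a squared unit norm and the bound is attained.\<close>
    have "R * transpose_mat T * T = R"
      using Rc Tc TT by (simp add: assoc_mult_mat[of _ m r _ r _ r])
    then show ?thesis
      using Rc Tc stiefel_column[OF R] by (simp add: inner power2_eq_square)
  qed
  ultimately show ?thesis
    by (simp add: is_arg_max_linorder)
qed

section \<open>Reduction of the quadratic objective to a linear one\<close>

lemma step_quadratic:
  assumes V: "V \<in> stiefel m r" and U: "U \<in> stiefel m r" and C: "C \<in> carrier_mat r p"
    and N: "N \<in> carrier_mat m p" and W: "W = (1 / h) \<cdot>\<^sub>m (V - U)"
  shows "frob_inner (W * C) (W * C) - 2 * frob_inner W (N * transpose_mat C) =
    2 / h\<^sup>2 * frob_inner C C + 2 / h * frob_inner (U * C) N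
    - 2 / h * frob_inner (N * transpose_mat C + (1 / h) \<cdot>\<^sub>m (U * C * transpose_mat C)) V"
proof -
  have Vc: "V \<in> carrier_mat m r" and Uc: "U \<in> carrier_mat m r"
    using V U by (auto simp: stiefel_def)
  have VC: "V * C \<in> carrier_mat m p" and UC: "U * C \<in> carrier_mat m p"
    using Vc Uc C by auto
  have WC: "W * C = (1 / h) \<cdot>\<^sub>m (V * C - U * C)"
    using Vc Uc C unfolding W
    by (subst mult_smult_assoc_mat[of _ m r]) (auto simp: minus_mult_distrib_mat[of _ m r])
  have Wc: "W \<in> carrier_mat m r"
    using Vc Uc unfolding W by auto
  \<comment> \<open>Shifting \<open>C\<close> to the left argument expresses every term through
    \<open>V * C\<close> and \<open>U * C\<close>.\<close>
  have lin: "frob_inner X (Z * transpose_mat C) = frob_inner (X * C) Z"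
    if "X \<in> carrier_mat m r" "Z \<in> carrier_mat m p" for X Z
    using frob_inner_mult_right_adjoint[OF that(1) C that(2)] by simp
  have "frob_inner (N * transpose_mat C + (1 / h) \<cdot>\<^sub>m (U * C * transpose_mat C)) V =
      frob_inner V (N * transpose_mat C + (1 / h) \<cdot>\<^sub>m (U * C * transpose_mat C))"
    using Vc Uc C N by (intro frob_inner_commute[of _ m r]) auto
  also have "\<dots> = frob_inner (V * C) N + 1 / h * frob_inner (V * C) (U * C)"
    using Vc C N UC
    by (simp add: frob_inner_add_right[of _ m r] frob_inner_smult_right[of _ m r] lin)
  finally have B: "frob_inner (N * transpose_mat C + (1 / h) \<cdot>\<^sub>m (U * C * transpose_mat C)) V =
      frob_inner (V * C) N + 1 / h * frob_inner (V * C) (U * C)" .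
  \<comment> \<open>Both \<open>V * C\<close> and \<open>U * C\<close> have the norm of
    \<open>C\<close>, so \<open>V\<close> survives only in the cross term. That term is the source
    of the summand with \<open>U * C * transpose_mat C\<close> in the trace matrix.\<close>
  have quad: "frob_inner (W * C) (W * C) = 1 / h\<^sup>2 * (2 * frob_inner C C - 2 * frob_inner (V * C) (U * C))"
    using VC UC minus_carrier_mat[OF UC, of "V * C"] stiefel_frob_inner_mult[OF V C] stiefel_frob_inner_mult[OF U C]
      frob_inner_commute[OF VC UC]
    by (simp add: WC frob_inner_smult_left[of _ m p] frob_inner_smult_right[of _ m p]
        frob_inner_diff_left[of _ m p] frob_inner_diff_right[of _ m p] power2_eq_square
        diff_divide_distrib)
  have "frob_inner W (N * transpose_mat C) = 1 / h * (frob_inner (V * C) N - frob_inner (U * C) N)"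
    using VC UC N Wc minus_carrier_mat[OF UC, of "V * C"]
    by (simp add: lin WC frob_inner_smult_left[of _ m p] frob_inner_diff_left[of _ m p])
  then show ?thesis
    unfolding B quad by (simp add: algebra_simps power2_eq_square diff_divide_distrib)
qed

section \<open>Dimensions of mode products and their unfoldings\<close>

lemma remove_nth_list_update: "remove_nth n (xs[n := x]) = remove_nth n xs"
  by (simp add: remove_nth_def)

lemma unfold_carrier:
  "unfold n X \<in> carrier_mat (dims X ! n) (prod_list (remove_nth n (dims X)))"
  by (simp add: unfold_def Let_def)

lemma dims_mode_prod: "dims (mode_prod X k U) = (dims X)[k := dim_row U]"
  by (simp add: mode_prod_def)

lemma length_dims_mode_prods: "length (dims (mode_prods ks X U)) = length (dims X)"
  unfolding mode_prods_def by (induction ks arbitrary: X) (simp_all add: dims_mode_prod)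

lemma dims_mode_prods_nth:
  assumes "i < length (dims X)"
  shows "dims (mode_prods ks X U) ! i = (if i \<in> set ks then dim_row (U i) else dims X ! i)"
  using assms unfolding mode_prods_def
  by (induction ks arbitrary: X) (auto simp: dims_mode_prod nth_list_update)

text \<open>Each mode other than \<open>n\<close> is multiplied by a transposed factor, so its size
  becomes the column number of \<open>U k\<close>; mode \<open>n\<close> keeps its full
  size.\<close>

lemma dims_project_except:
  assumes "length rs = length (dims X)" "n < length rs"
    and "\<And>k. k < length rs \<Longrightarrow> dim_col (U k) = rs ! k"
  shows "dims (project_except n X U) = rs[n := dims X ! n]"
  unfolding project_except_def
  by (rule nth_equalityI)
     (use assms in \<open>auto simp: length_dims_mode_prods dims_mode_prods_nth nth_list_update\<close>)

text \<open>Equivalence of the two problems is read as equality of their solution sets. The product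
  \<open>R * transpose_mat T\<close> is claimed to be a solution, not the only one: a zero singular
  value can make the maximizer non-unique.\<close>

theorem theorem3:
  fixes d n :: nat and ds rs :: "nat list" and h :: real
    and Y C dA dC :: tensor and U dU :: "nat \<Rightarrow> real mat"
  assumes "d \<ge> 2" and "length ds = d" and "length rs = d"
    and "\<forall>k<d. rs ! k \<le> ds ! k"
    and "C \<in> tensors rs"
    and "\<forall>k<d. U k \<in> stiefel (ds ! k) (rs ! k)"
    and "Y = tucker C U" and "Y \<in> tucker_manifold ds rs"
    and "h > 0" and "n < d"
    and "dA \<in> tensors ds" and "dC \<in> tensors rs"
    and "\<forall>k<d. k \<noteq> n \<longrightarrow> dU k \<in> carrier_mat (ds ! k) (rs ! k)"
  shows "(\<forall>V. is_arg_min (step_objective h n C U dA dC dU) (\<lambda>V. V \<in> stiefel (ds ! n) (rs ! n)) V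
            \<longleftrightarrow> is_arg_max (\<lambda>V. mat_trace (transpose_mat (trace_matrix h n C U dA dC dU) * V))
                  (\<lambda>V. V \<in> stiefel (ds ! n) (rs ! n)) V)
    \<and> (\<forall>R S T. economy_svd (ds ! n) (rs ! n) (trace_matrix h n C U dA dC dU) R S T \<longrightarrow>
          is_arg_max (\<lambda>V. mat_trace (transpose_mat (trace_matrix h n C U dA dC dU) * V))
            (\<lambda>V. V \<in> stiefel (ds ! n) (rs ! n)) (R * transpose_mat T)
          \<and> is_arg_min (step_objective h n C U dA dC dU)
            (\<lambda>V. V \<in> stiefel (ds ! n) (rs ! n)) (R * transpose_mat T))"
proof -
  define m r p where "m = ds ! n" and "r = rs ! n" and "p = prod_list (remove_nth n rs)"
  define K where "K = {..<length (dims C)} - {n}"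
  define Cn Dn P where "Cn = unfold n C" and "Dn = unfold n dC"
    and "P = unfold n (project_except n dA U)"
  define M where "M = (\<lambda>k. unfold n (mode_prod C k (transpose_mat (U k) * dU k)))"
  \<comment> \<open>\<open>N\<close> is the bracket in front of the transposed unfolded core in the
    trace matrix, which gives \<open>B\<close> the shape treated in
    \<open>step_quadratic\<close>.\<close>
  define N where "N = P - U n * Dn - U n * mat_sum r p M K"
  define B where "B = trace_matrix h n C U dA dC dU"
  have dims: "dims C = rs" "dims dC = rs" "dims dA = ds"
    using assms by (auto simp: tensors_def)
  have Uk: "U k \<in> carrier_mat (ds ! k) (rs ! k)" if "k < d" for k
    using assms that by (auto simp: stiefel_def)
  have Un: "U n \<in> stiefel m r" and Unc: "U n \<in> carrier_mat m r"
    using assms Uk by (auto simp: m_def r_def)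
  have Cn: "Cn \<in> carrier_mat r p" and Dn: "Dn \<in> carrier_mat r p"
    using unfold_carrier[of n C] unfold_carrier[of n dC]
    by (auto simp: Cn_def Dn_def r_def p_def dims)
  \<comment> \<open>Only the size of mode \<open>n\<close> differs from \<open>rs\<close>, so this
    unfolding has the same \<open>p\<close> columns as that of the core.\<close>
  have "dims (project_except n dA U) = rs[n := m]"
    using dims_project_except[of rs dA n U] carrier_matD(2)[OF Uk] assms by (simp add: dims m_def)
  then have P: "P \<in> carrier_mat m p"
    using unfold_carrier[of n "project_except n dA U"] assms
    by (simp add: P_def p_def remove_nth_list_update)
  have M: "M k \<in> carrier_mat r p" if "k \<in> K" for k
  proof -
    have "k < d"
      using that assms by (auto simp: K_def dims)
    \<comment> \<open>The multiplying matrix inherits \<open>rs ! k\<close> rows from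
      \<open>transpose_mat (U k)\<close>, so mode \<open>k\<close> keeps its size.\<close>
    then have "dims (mode_prod C k (transpose_mat (U k) * dU k)) = rs"
      using carrier_matD(2)[OF Uk] by (simp add: dims_mode_prod dims)
    then show ?thesis
      using unfold_carrier[of n "mode_prod C k (transpose_mat (U k) * dU k)"]
      by (simp add: M_def r_def p_def)
  qed
  have MS: "mat_sum r p M K \<in> carrier_mat r p"
    by (simp add: mat_sum_def)
  have N: "N \<in> carrier_mat m p"
    using P Unc Dn MS by (auto simp: N_def)
  have B_eq: "B = N * transpose_mat Cn + (1 / h) \<cdot>\<^sub>m (U n * Cn * transpose_mat Cn)"
    by (simp add: B_def trace_matrix_def N_def P_def Dn_def Cn_def M_def K_def r_def p_def dims)
  have Bc: "B \<in> carrier_mat m r"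
    using N Unc Cn by (auto simp: B_eq)
  \<comment> \<open>By linearity the three linear contributions collapse into one inner product with
    \<open>N\<close>.\<close>
  have objective: "als_objective n C U dA dC dU W =
      frob_inner (W * Cn) (W * Cn) - 2 * frob_inner W (N * transpose_mat Cn)"
    if W: "W \<in> carrier_mat m r" for W
  proof -
    have WC: "W * Cn \<in> carrier_mat m p"
      using W Cn by auto
    have lin: "frob_inner W (Z * transpose_mat Cn) = frob_inner (W * Cn) Z"
      if "Z \<in> carrier_mat m p" for Z
      using frob_inner_mult_right_adjoint[OF W Cn that] by simp
    \<comment> \<open>With \<open>U n\<close> moved away, the matrix sum stands alone in the second
      argument, where the inner product can be taken termwise.\<close>
    have left: "frob_inner (W * Cn) (U n * Z) = frob_inner (transpose_mat (U n) * (W * Cn)) Z"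
      if "Z \<in> carrier_mat r p" for Z
      using that WC Unc
        frob_inner_mult_left_adjoint[of "transpose_mat (U n)" r m "W * Cn" p Z] by simp
    have "frob_inner (W * Cn) (U n * mat_sum r p M K) = (\<Sum>k\<in>K. frob_inner (W * Cn) (U n * M k))"
      using WC Unc M MS by (simp add: left frob_inner_mat_sum_right[of _ r p])
    then have "frob_inner W (N * transpose_mat Cn) = frob_inner (W * Cn) P
        - frob_inner (W * Cn) (U n * Dn) - (\<Sum>k\<in>K. frob_inner (W * Cn) (U n * M k))"
      using WC P Unc Dn MS N minus_carrier_mat[OF mult_carrier_mat[OF Unc Dn], of P]
      by (simp add: lin) (simp add: N_def frob_inner_diff_right[of _ m p])
    moreover have "als_objective n C U dA dC dU W = frob_inner (W * Cn) (W * Cn)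
        - 2 * frob_inner W (P * transpose_mat Cn) + 2 * frob_inner W (U n * Dn * transpose_mat Cn)
        + 2 * (\<Sum>k\<in>K. frob_inner W (U n * M k * transpose_mat Cn))"
      by (simp add: als_objective_def frob_norm_sq Cn_def Dn_def P_def M_def K_def)
    ultimately show ?thesis
      using P Unc Dn M by (simp add: lin)
  qed
  \<comment> \<open>These are the terms of \<open>step_quadratic\<close> that do not contain
    \<open>V\<close>.\<close>
  define c where "c = 2 / h\<^sup>2 * frob_inner Cn Cn + 2 / h * frob_inner (U n * Cn) N"
  have step: "step_objective h n C U dA dC dU V = c - 2 / h * frob_inner B V"
    if V: "V \<in> stiefel m r" for V
    using objective[of "(1 / h) \<cdot>\<^sub>m (V - U n)"] Unc minus_carrier_mat[OF Unc, of V]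
      step_quadratic[OF V Un Cn N refl, of h]
    by (simp add: step_objective_def c_def B_eq)
  have tr: "mat_trace (transpose_mat B * V) = frob_inner B V" if "V \<in> stiefel m r" for V
    using that Bc by (simp add: frob_inner_eq_trace[of _ m r] stiefel_def)
  \<comment> \<open>On the feasible set the objective is \<open>c\<close> minus a positive multiple
    of the trace, so the order is exactly reversed.\<close>
  have min_iff: "is_arg_min (step_objective h n C U dA dC dU) (\<lambda>V. V \<in> stiefel m r) V \<longleftrightarrow>
      is_arg_max (\<lambda>V. mat_trace (transpose_mat B * V)) (\<lambda>V. V \<in> stiefel m r) V" for V
    using \<open>h > 0\<close> by (auto simp: is_arg_min_linorder is_arg_max_linorder step tr
      divide_le_cancel)
  have svd: "is_arg_max (\<lambda>V. mat_trace (transpose_mat B * V)) (\<lambda>V. V \<in> stiefel m r)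
      (R * transpose_mat T)" if "economy_svd m r B R S T" for R S T
    using economy_svd_is_arg_max[OF that] by (auto simp: is_arg_max_linorder tr)
  show ?thesis
    using min_iff svd unfolding B_def m_def r_def by blast
qed

end
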